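(* Let $L$ be a kernel of an idempotent semifield $\mathbb{S}$. Suppose $L$ has a composition series $$\mathcal{C}:\quad L=L_0\supset L_1\supset\dots\supset L_t=\langle1\rangle .$$ Then: (1) Any arbitrary finite chain of subkernels $L=K_0\supset K_1\supset\dots\supset K_s$ can be refined to a composition series equivalent to $\mathcal{C}$. In particular $s\le t$. (2) Any two composition series of $L$ are equivalent. (3) $\ell(L)=\ell(K)+\ell(L/K)$ for every subkernel $K$ of $L$. In particular, every subkernel and every homomorphic image of a kernel with a composition series has a composition series.
   Context: Semifields are commutative, have no zero element and are not fields; idempotent means $a+a=a$. A kernel of a semifield $\mathbb{S}$ is a multiplicative subgroup $K$ such that $xa+yb\in K$ whenever $a,b\in K$, $x,y\in\mathbb{S}$, $x+y=1$. In an idempotent semifield every kernel is a subsemifield. If $K_1\subseteq K_2$ are kernels of $\mathbb{S}$, then $K_1$ is a kernel of $K_2$, and is called a subkernel of $K_2$. A kernel is simple if it contains no kernels other than $\{1\}$ and itself; a semifield is simple if it is simple as a kernel of itself. For a descending chain $L=K_0\supset K_1\supset\dots\supset K_t$ of subkernels of $L$, $t$ is its length and its factors are the quotients $K_{i-1}/K_i$, $1\le i\le t$. It is a composition series for $L$ if $K_t=\langle1\rangle=\{1\}$ and each factor is simple. Two chains are equivalent if they have isomorphic factors. Refining a chain means inserting additional subkernels into it. $\ell(L)$ denotes the length of a composition series of $L$, if one exists. *)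

theory Defs
  imports "HOL-Algebra.Coset" "HOL-Library.Sublist"
begin

record 'a semifield = "'a monoid" +
  sf_add :: "['a, 'a] \<Rightarrow> 'a" (infixl "\<boxplus>\<index>" 65)

text \<open>Every element of the carrier is invertible, so a semifield has no zero element and is
  never a field. The one-element semifield is admitted, since the trivial kernel is a subsemifield.\<close>

locale semifield = comm_group S for S (structure) +
  assumes add_closed: "\<lbrakk>x \<in> carrier S; y \<in> carrier S\<rbrakk> \<Longrightarrow> x \<boxplus> y \<in> carrier S"
    and add_assoc: "\<lbrakk>x \<in> carrier S; y \<in> carrier S; z \<in> carrier S\<rbrakk>
      \<Longrightarrow> (x \<boxplus> y) \<boxplus> z = x \<boxplus> (y \<boxplus> z)"
    and add_comm: "\<lbrakk>x \<in> carrier S; y \<in> carrier S\<rbrakk> \<Longrightarrow> x \<boxplus> y = y \<boxplus> x"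
    and distrib: "\<lbrakk>x \<in> carrier S; y \<in> carrier S; z \<in> carrier S\<rbrakk>
      \<Longrightarrow> x \<otimes> (y \<boxplus> z) = (x \<otimes> y) \<boxplus> (x \<otimes> z)"

locale idempotent_semifield = semifield +
  assumes add_idem: "x \<in> carrier S \<Longrightarrow> x \<boxplus> x = x"

locale semifield_kernel = subgroup K S for K and S (structure) +
  assumes convex_comb: "\<lbrakk>a \<in> K; b \<in> K; x \<in> carrier S; y \<in> carrier S; x \<boxplus> y = \<one>\<rbrakk>
      \<Longrightarrow> (x \<otimes> a) \<boxplus> (y \<otimes> b) \<in> K"

text \<open>A subkernel of a kernel \<open>L\<close> of \<open>S\<close> is a kernel of the ambient semifield \<open>S\<close> contained in \<open>L\<close>.\<close>

definition subkernel :: "('a, 'm) semifield_scheme \<Rightarrow> 'a set \<Rightarrow> 'a set \<Rightarrow> bool" where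
  "subkernel S L K \<longleftrightarrow> semifield_kernel K S \<and> K \<subseteq> L"

text \<open>The trivial kernel counts as simple; this never matters for the factors of a chain,
  because chains below are strictly descending.\<close>

definition simple_kernel :: "('a, 'm) semifield_scheme \<Rightarrow> 'a set \<Rightarrow> bool" where
  "simple_kernel S L \<longleftrightarrow> semifield_kernel L S \<and>
    (\<forall>K. semifield_kernel K S \<and> K \<subseteq> L \<longrightarrow> K = {\<one>\<^bsub>S\<^esub>} \<or> K = L)"

definition simple_semifield :: "('a, 'm) semifield_scheme \<Rightarrow> bool" where
  "simple_semifield S \<longleftrightarrow> simple_kernel S (carrier S)"

definition subsemifield_of :: "('a, 'm) semifield_scheme \<Rightarrow> 'a set \<Rightarrow> ('a, 'm) semifield_scheme" where
  "subsemifield_of S L = S\<lparr>carrier := L\<rparr>"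

text \<open>For a kernel \<open>K\<close>, the elementwise sum of the cosets of \<open>a\<close> and \<open>b\<close> is exactly the coset of
  \<open>a \<boxplus> b\<close>: a sum of \<open>a \<otimes> k\<close> and \<open>b \<otimes> k'\<close> is \<open>a \<boxplus> b\<close> times a combination of \<open>k\<close> and \<open>k'\<close> whose
  coefficients \<open>a / (a \<boxplus> b)\<close> and \<open>b / (a \<boxplus> b)\<close> add up to \<open>\<one>\<close>.\<close>

definition quotient_semifield ::
    "('a, 'm) semifield_scheme \<Rightarrow> 'a set \<Rightarrow> 'a set semifield" where
  "quotient_semifield S K =
    \<lparr>carrier = rcosets\<^bsub>S\<^esub> K, mult = set_mult S, one = K,
     sf_add = (\<lambda>A B. \<Union>a\<in>A. \<Union>b\<in>B. {a \<boxplus>\<^bsub>S\<^esub> b})\<rparr>"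

definition kernel_quotient ::
    "('a, 'm) semifield_scheme \<Rightarrow> 'a set \<Rightarrow> 'a set \<Rightarrow> 'a set semifield" where
  "kernel_quotient S L K = quotient_semifield (subsemifield_of S L) K"

definition semifield_hom ::
    "('a, 'm) semifield_scheme \<Rightarrow> ('b, 'n) semifield_scheme \<Rightarrow> ('a \<Rightarrow> 'b) set" where
  "semifield_hom S T = {h \<in> hom S T.
    \<forall>x\<in>carrier S. \<forall>y\<in>carrier S. h (x \<boxplus>\<^bsub>S\<^esub> y) = h x \<boxplus>\<^bsub>T\<^esub> h y}"

definition semifield_isomorphic ::
    "('a, 'm) semifield_scheme \<Rightarrow> ('b, 'n) semifield_scheme \<Rightarrow> bool" where
  "semifield_isomorphic S T \<longleftrightarrow>
    (\<exists>h \<in> semifield_hom S T. bij_betw h (carrier S) (carrier T))"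

text \<open>A chain \<open>L = K\<^sub>0 \<supset> K\<^sub>1 \<supset> \<dots> \<supset> K\<^sub>t\<close> is the list \<open>[K\<^sub>0, \<dots>, K\<^sub>t]\<close>; its length as a chain is
  one less than its length as a list.\<close>

definition subkernel_chain ::
    "('a, 'm) semifield_scheme \<Rightarrow> 'a set \<Rightarrow> 'a set list \<Rightarrow> bool" where
  "subkernel_chain S L Ks \<longleftrightarrow>
    Ks \<noteq> [] \<and> hd Ks = L \<and> (\<forall>K \<in> set Ks. subkernel S L K) \<and> sorted_wrt (\<supset>) Ks"

definition chain_length :: "'a set list \<Rightarrow> nat" where
  "chain_length Ks = length Ks - 1"

definition chain_factor ::
    "('a, 'm) semifield_scheme \<Rightarrow> 'a set list \<Rightarrow> nat \<Rightarrow> 'a set semifield" where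
  "chain_factor S Ks i = kernel_quotient S (Ks ! i) (Ks ! Suc i)"

definition composition_series ::
    "('a, 'm) semifield_scheme \<Rightarrow> 'a set \<Rightarrow> 'a set list \<Rightarrow> bool" where
  "composition_series S L Ks \<longleftrightarrow>
    subkernel_chain S L Ks \<and> last Ks = {\<one>\<^bsub>S\<^esub>} \<and>
    (\<forall>i < chain_length Ks. simple_semifield (chain_factor S Ks i))"

text \<open>As usual for composition series, the factors are compared up to reordering.\<close>

definition equivalent_chains ::
    "('a, 'm) semifield_scheme \<Rightarrow> 'a set list \<Rightarrow> 'a set list \<Rightarrow> bool" where
  "equivalent_chains S Ks Ms \<longleftrightarrow>
    (\<exists>\<pi>. bij_betw \<pi> {..<chain_length Ks} {..<chain_length Ms} \<and>
      (\<forall>i < chain_length Ks.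
        semifield_isomorphic (chain_factor S Ks i) (chain_factor S Ms (\<pi> i))))"

definition chain_refinement ::
    "('a, 'm) semifield_scheme \<Rightarrow> 'a set \<Rightarrow> 'a set list \<Rightarrow> 'a set list \<Rightarrow> bool" where
  "chain_refinement S L Ks Ms \<longleftrightarrow>
    subkernel_chain S L Ks \<and> subkernel_chain S L Ms \<and> subseq Ks Ms"

definition has_composition_series :: "('a, 'm) semifield_scheme \<Rightarrow> 'a set \<Rightarrow> bool" where
  "has_composition_series S L \<longleftrightarrow> (\<exists>Ks. composition_series S L Ks)"

definition kernel_length :: "('a, 'm) semifield_scheme \<Rightarrow> 'a set \<Rightarrow> nat" where
  "kernel_length S L = (THE n. \<exists>Ks. composition_series S L Ks \<and> chain_length Ks = n)"

end

theory Submission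
  imports Defs "HOL-Combinatorics.List_Permutation"
begin

text \<open>An idempotent semifield is an abelian lattice-ordered group whose kernels are the convex
  lattice-ordered subgroups, so kernels form a modular lattice under intersection and product, the
  kernels of a factor \<open>L/K\<close> are the kernels of \<open>S\<close> between \<open>K\<close> and \<open>L\<close>, and a factor is simple iff
  there is no kernel strictly in between. Given a composition series \<open>L \<supset> X \<supset> \<dots>\<close> and a kernel
  \<open>K \<subseteq> L\<close>, induction on the length yields an equivalent series through \<open>K\<close>: if \<open>K \<subseteq> X\<close>, recurse
  into \<open>X\<close>; otherwise \<open>KX = L\<close>, hence \<open>K/(K \<inter> X) \<cong> L/X\<close>, and the part from \<open>X\<close> to \<open>K \<inter> X\<close> of a
  series of \<open>X\<close> through \<open>K \<inter> X\<close> is moved by multiplication with \<open>K\<close> to a chain from \<open>L\<close> to \<open>K\<close>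
  with isomorphic factors.\<close>

section \<open>Kernels of idempotent semifields\<close>

context semifield
begin

lemma add_left_comm:
  "\<lbrakk>x \<in> carrier S; y \<in> carrier S; z \<in> carrier S\<rbrakk> \<Longrightarrow> x \<boxplus> (y \<boxplus> z) = y \<boxplus> (x \<boxplus> z)"
  by (metis add_assoc add_comm)

lemma distrib_right:
  "\<lbrakk>x \<in> carrier S; y \<in> carrier S; z \<in> carrier S\<rbrakk> \<Longrightarrow> (x \<boxplus> y) \<otimes> z = (x \<otimes> z) \<boxplus> (y \<otimes> z)"
  by (simp add: distrib m_comm add_closed)

text \<open>Dividing \<open>x\<close> and \<open>y\<close> by \<open>x \<boxplus> y\<close> makes
  them add up to one, so the defining condition of a kernel extends to arbitrary coefficients at the
  cost of the factor \<open>x \<boxplus> y\<close>.\<close>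

lemma kernel_combination:
  assumes K: "semifield_kernel K S" and ab: "a \<in> K" "b \<in> K"
    and xy: "x \<in> carrier S" "y \<in> carrier S"
  obtains k where "k \<in> K" "(x \<otimes> a) \<boxplus> (y \<otimes> b) = k \<otimes> (x \<boxplus> y)"
proof
  interpret K: semifield_kernel K S by fact
  let ?i = "inv (x \<boxplus> y)"
  let ?k = "((x \<otimes> ?i) \<otimes> a) \<boxplus> ((y \<otimes> ?i) \<otimes> b)"
  have cl: "a \<in> carrier S" "b \<in> carrier S" "x \<boxplus> y \<in> carrier S" "?i \<in> carrier S"
    using ab xy K.subset by (auto intro: add_closed)
  have "(x \<otimes> ?i) \<boxplus> (y \<otimes> ?i) = \<one>"
    using xy cl by (simp add: distrib_right[symmetric])
  then show "?k \<in> K"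
    using ab xy cl by (intro K.convex_comb) auto
  have "\<And>u c. u \<in> carrier S \<Longrightarrow> c \<in> carrier S \<Longrightarrow> ((u \<otimes> ?i) \<otimes> c) \<otimes> (x \<boxplus> y) = u \<otimes> c"
    using cl by (simp add: m_ac)
  then show "(x \<otimes> a) \<boxplus> (y \<otimes> b) = ?k \<otimes> (x \<boxplus> y)"
    using xy cl by (simp add: distrib_right)
qed

lemma kernel_carrier: "semifield_kernel (carrier S) S"
  by unfold_locales (auto intro: add_closed)

lemma kernel_Int:
  assumes "semifield_kernel A S" "semifield_kernel B S"
  shows "semifield_kernel (A \<inter> B) S"
proof -
  interpret A: semifield_kernel A S by fact
  interpret B: semifield_kernel B S by fact
  show ?thesis
    using A.subset by unfold_locales (auto intro: A.convex_comb B.convex_comb)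
qed

text \<open>In a combination of \<open>a \<otimes> b\<close> and \<open>a' \<otimes> b'\<close>, the
  products \<open>x \<otimes> a\<close> and \<open>y \<otimes> a'\<close> are read as coefficients
  of \<open>b\<close> and \<open>b'\<close>. Then \<open>kernel_combination\<close> splits off one
  element of \<open>B\<close>, and what remains is a combination of \<open>a\<close> and
  \<open>a'\<close> that lies in \<open>A\<close>.\<close>

lemma kernel_set_mult:
  assumes A: "semifield_kernel A S" and B: "semifield_kernel B S"
  shows "semifield_kernel (A <#> B) S"
proof -
  interpret A: semifield_kernel A S by fact
  interpret B: semifield_kernel B S by fact
  interpret AB: subgroup "A <#> B" S
    by (intro mult_subgroups A.is_subgroup B.is_subgroup)
  show ?thesis
  proof unfold_locales
    fix u v x y
    assume uv: "u \<in> A <#> B" "v \<in> A <#> B" and x: "x \<in> carrier S" and y: "y \<in> carrier S"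
      and xy: "x \<boxplus> y = \<one>"
    obtain a b a' b' where u: "a \<in> A" "b \<in> B" "u = a \<otimes> b" and v: "a' \<in> A" "b' \<in> B" "v = a' \<otimes> b'"
      using uv by (auto simp: set_mult_def)
    have cl: "a \<in> carrier S" "a' \<in> carrier S" "b \<in> carrier S" "b' \<in> carrier S"
      using u v A.subset B.subset by auto
    obtain k where k: "k \<in> B"
      "((x \<otimes> a) \<otimes> b) \<boxplus> ((y \<otimes> a') \<otimes> b') = k \<otimes> ((x \<otimes> a) \<boxplus> (y \<otimes> a'))"
      using kernel_combination[OF B, of b b' "x \<otimes> a" "y \<otimes> a'"] u v x y cl by auto
    have "(x \<otimes> a) \<boxplus> (y \<otimes> a') \<in> A"
      using u v x y xy by (intro A.convex_comb) auto
    moreover have "(x \<otimes> u) \<boxplus> (y \<otimes> v) = ((x \<otimes> a) \<boxplus> (y \<otimes> a')) \<otimes> k"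
      using k u v x y cl B.subset by (auto simp: m_assoc m_comm[of k] add_closed)
    ultimately show "(x \<otimes> u) \<boxplus> (y \<otimes> v) \<in> A <#> B"
      using k(1) unfolding set_mult_def by auto
  qed
qed

lemma kernel_set_mult_upper:
  assumes "semifield_kernel A S" "semifield_kernel B S"
  shows "A \<subseteq> A <#> B" "B \<subseteq> A <#> B"
proof -
  interpret A: semifield_kernel A S by fact
  interpret B: semifield_kernel B S by fact
  show "A \<subseteq> A <#> B"
    unfolding set_mult_def using A.subset B.one_closed by (force intro: r_one[symmetric])
  show "B \<subseteq> A <#> B"
    unfolding set_mult_def using B.subset A.one_closed by (force intro: l_one[symmetric])
qed

lemma kernel_set_mult_least:
  assumes "semifield_kernel C S" "A \<subseteq> C" "B \<subseteq> C"
  shows "A <#> B \<subseteq> C"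
proof -
  interpret C: semifield_kernel C S by fact
  show ?thesis using assms(2,3) by (auto simp: set_mult_def)
qed

lemma kernel_set_mult_commute:
  assumes "semifield_kernel A S" "semifield_kernel B S"
  shows "A <#> B = B <#> A"
  by (intro equalityI kernel_set_mult_least kernel_set_mult kernel_set_mult_upper assms)

text \<open>The nontrivial half of Dedekind's modular law: if \<open>x \<otimes> b\<close> and
  \<open>x\<close> lie in \<open>A\<close>, then so does \<open>b\<close>.\<close>

lemma kernel_modular:
  assumes A: "semifield_kernel A S" and B: "semifield_kernel B S" and X: "semifield_kernel X S"
    and "X \<subseteq> A"
  shows "A \<inter> (X <#> B) \<subseteq> X <#> (A \<inter> B)"
proof
  interpret A: semifield_kernel A S by fact
  interpret B: semifield_kernel B S by fact
  fix c assume c: "c \<in> A \<inter> (X <#> B)"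
  then obtain x b where xb: "x \<in> X" "b \<in> B" "c = x \<otimes> b"
    by (auto simp: set_mult_def)
  have "x \<in> A" using xb assms(4) by auto
  then have "b = inv x \<otimes> c"
    using xb A.subset B.subset by (auto simp: m_assoc[symmetric])
  then have "b \<in> A" using \<open>x \<in> A\<close> c by auto
  then show "c \<in> X <#> (A \<inter> B)"
    using xb by (auto simp: set_mult_def)
qed

end

section \<open>Kernels of a kernel, the latter viewed as a semifield of its own\<close>

lemma semifield_kernel_subsemifieldI:
  assumes K: "semifield_kernel K S" and L: "semifield_kernel L S" and KL: "K \<subseteq> L" and "group S"
  shows "semifield_kernel K (subsemifield_of S L)"
proof -
  interpret group S by fact
  interpret K: semifield_kernel K S by fact
  interpret L: semifield_kernel L S by fact
  have "subgroup K (subsemifield_of S L)"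
    unfolding subsemifield_of_def
    using KL K.is_subgroup L.is_subgroup by (rule subgroup_incl[rotated 2])
  then show ?thesis
    using K.convex_comb L.subset
    by (auto simp: semifield_kernel_def semifield_kernel_axioms_def subsemifield_of_def)
qed

context idempotent_semifield
begin

text \<open>Idempotency says that one plus one is one, so a plain sum is a combination with both
  coefficients equal to one.\<close>

lemma kernel_add_closed:
  assumes "semifield_kernel K S" "a \<in> K" "b \<in> K"
  shows "a \<boxplus> b \<in> K"
proof -
  interpret K: semifield_kernel K S by fact
  show ?thesis
    using K.convex_comb[of a b \<one> \<one>] assms(2,3) K.subset by (auto simp: add_idem subsetD)
qed

lemma subsemifield_idempotent_semifield:
  assumes "semifield_kernel L S"
  shows "idempotent_semifield (subsemifield_of S L)"
proof -
  interpret L: semifield_kernel L S by fact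
  interpret LS: group "subsemifield_of S L"
    unfolding subsemifield_of_def by (rule subgroup_imp_group[OF L.is_subgroup])
  show ?thesis
    using L.subset kernel_add_closed[OF assms]
    by unfold_locales (auto simp: subsemifield_of_def m_comm add_assoc add_comm add_left_comm distrib
        add_idem subset_eq)
qed

text \<open>With \<open>a \<le> b\<close> meaning \<open>a \<boxplus> b = b\<close>, an idempotent semifield is a lattice-ordered group
  and its kernels are convex. This is why a kernel of a kernel of \<open>S\<close> is a kernel of \<open>S\<close>.\<close>

lemma kernel_convex:
  assumes "semifield_kernel K S" and ab: "a \<in> K" "b \<in> K" and x: "x \<in> carrier S"
    and "a \<boxplus> x = x" "x \<boxplus> b = b"
  shows "x \<in> K"
proof -
  interpret K: semifield_kernel K S by fact
  have cl: "a \<in> carrier S" "b \<in> carrier S" using ab K.subset by auto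
  \<comment> \<open>Since \<open>x\<close> is at most \<open>b\<close>, \<open>?v\<close> is at most
    one, so one and \<open>?v\<close> add up to one and serve as coefficients. The combination of
    one and \<open>?c\<close> is one plus \<open>x / a\<close>, which equals \<open>x / a\<close>
    because \<open>a\<close> is at most \<open>x\<close>.\<close>
  let ?v = "x \<otimes> inv b" and ?c = "b \<otimes> inv a"
  have "\<one> \<boxplus> ?v = (b \<boxplus> x) \<otimes> inv b"
    using cl x by (simp add: distrib_right)
  also have "\<dots> = \<one>"
    using assms(6) cl x by (simp add: add_comm)
  finally have "(\<one> \<otimes> \<one>) \<boxplus> (?v \<otimes> ?c) \<in> K"
    using ab cl x by (intro K.convex_comb) auto
  moreover have "?v \<otimes> ?c = x \<otimes> inv a"
  proof -
    have "?v \<otimes> ?c = x \<otimes> (inv b \<otimes> b) \<otimes> inv a" using cl x by (simp only: m_assoc m_closed inv_closed)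
    then show ?thesis using cl x by simp
  qed
  ultimately have "(a \<otimes> inv a) \<boxplus> (x \<otimes> inv a) \<in> K"
    using cl x by simp
  then have "(a \<boxplus> x) \<otimes> inv a \<in> K"
    using cl x by (simp only: distrib_right inv_closed)
  then have "x \<otimes> inv a \<otimes> a \<in> K"
    using assms(5) ab by auto
  then show ?thesis using cl x by (simp add: m_assoc)
qed

text \<open>Coefficients from \<open>S\<close> may lie outside \<open>L\<close>, so the kernel
  condition of \<open>K\<close> inside \<open>L\<close> does not apply to them. Instead the
  combination lies in \<open>L\<close>, because \<open>L\<close> is a kernel, and between the meet
  and the join of \<open>a\<close> and \<open>b\<close>, which belong to \<open>K\<close>; convexity
  of \<open>K\<close> inside \<open>L\<close> then places it in \<open>K\<close>.\<close>

lemma kernel_subsemifieldD: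
  assumes K: "semifield_kernel K (subsemifield_of S L)" and L: "semifield_kernel L S"
  shows "semifield_kernel K S"
proof -
  interpret L: semifield_kernel L S by fact
  interpret K: semifield_kernel K "subsemifield_of S L" by fact
  interpret LS: idempotent_semifield "subsemifield_of S L"
    by (rule subsemifield_idempotent_semifield[OF L])
  have sub: "K \<subseteq> L" using K.subset by (simp add: subsemifield_of_def)
  have inv: "inv\<^bsub>subsemifield_of S L\<^esub> x = inv x" if "x \<in> L" for x
    using that L.is_subgroup by (simp add: subsemifield_of_def m_inv_consistent)
  interpret KS: subgroup K S
    using sub L.subset K.m_closed K.one_closed K.m_inv_closed inv
    by unfold_locales (auto simp: subsemifield_of_def subset_eq)
  show ?thesis
  proof unfold_locales
    fix a b x y
    assume ab: "a \<in> K" "b \<in> K" and x: "x \<in> carrier S" and y: "y \<in> carrier S" and xy: "x \<boxplus> y = \<one>"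
    have cl: "a \<in> carrier S" "b \<in> carrier S" using ab KS.subset by auto
    have addK: "u \<boxplus> v \<in> K" if "u \<in> K" "v \<in> K" for u v
      using LS.kernel_add_closed[OF K that] by (simp add: subsemifield_of_def)
    \<comment> \<open>The join of \<open>a\<close> and \<open>b\<close> is their sum; the inverse
      \<open>?m\<close> of the sum of their inverses is their meet.\<close>
    let ?c = "(x \<otimes> a) \<boxplus> (y \<otimes> b)" and ?n = "inv a \<boxplus> inv b"
    let ?m = "inv ?n"
    have M: "a \<boxplus> b \<in> K" and m: "?m \<in> K" and n: "?n \<in> K" using ab addK by auto
    have ncl: "?n \<in> carrier S" "?m \<in> carrier S" using m n KS.subset by auto
    have c: "?c \<in> L" using ab sub x y xy by (intro L.convex_comb) auto
    \<comment> \<open>A coefficient \<open>u\<close> that has a complement \<open>v\<close> is at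
      most one, so multiplication by it can only decrease \<open>d\<close>.\<close>
    have absorb: "(u \<otimes> d) \<boxplus> d = d" if "u \<in> carrier S" "v \<in> carrier S" "u \<boxplus> v = \<one>" "d \<in> carrier S"
      for u v d
    proof -
      have "d = (u \<otimes> d) \<boxplus> (v \<otimes> d)"
        using that by (metis distrib_right l_one)
      then show ?thesis
        using that by (metis add_assoc add_idem m_closed)
    qed
    have "?c \<boxplus> (a \<boxplus> b) = ((x \<otimes> a) \<boxplus> a) \<boxplus> ((y \<otimes> b) \<boxplus> b)"
      using x y cl by (simp add: add_assoc add_left_comm add_closed)
    also have "\<dots> = a \<boxplus> b"
      using absorb[of x y a] absorb[of y x b] x y xy cl by (simp add: add_comm)
    finally have upper: "?c \<boxplus> (a \<boxplus> b) = a \<boxplus> b" .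
    \<comment> \<open>Inversion reverses the order: multiplying the inequality between
      \<open>inv d\<close> and \<open>?n\<close> by \<open>d \<otimes> ?m\<close> turns it into one
      between \<open>?m\<close> and \<open>d\<close>.\<close>
    have lower_gen: "?m \<boxplus> d = d" if d: "d \<in> carrier S" and "inv d \<boxplus> ?n = ?n" for d
    proof -
      have "(inv d \<boxplus> ?n) \<otimes> (d \<otimes> ?m) = ?m \<boxplus> d"
        using d ncl by (simp add: distrib_right m_assoc[symmetric] m_comm[of ?n])
          (simp add: m_assoc)
      moreover have "?n \<otimes> (d \<otimes> ?m) = d"
        using d ncl by (simp add: m_ac)
      ultimately show ?thesis using that by simp
    qed
    have ma: "?m \<boxplus> a = a"
      using cl by (intro lower_gen) (simp_all add: add_assoc[symmetric] add_idem)
    have mb: "?m \<boxplus> b = b"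
      using cl by (intro lower_gen)
        (simp_all add: add_left_comm[of "inv b"] add_idem)
    \<comment> \<open>Splitting \<open>?m\<close> with the same coefficients \<open>x\<close> and
      \<open>y\<close> allows it to be absorbed termwise by \<open>a\<close> and
      \<open>b\<close>.\<close>
    have "?m = (x \<otimes> ?m) \<boxplus> (y \<otimes> ?m)"
      using x y xy ncl by (metis distrib_right l_one)
    then have "?m \<boxplus> ?c = ((x \<otimes> ?m) \<boxplus> (y \<otimes> ?m)) \<boxplus> ?c" by simp
    also have "\<dots> = (x \<otimes> (?m \<boxplus> a)) \<boxplus> (y \<otimes> (?m \<boxplus> b))"
      using x y cl ncl by (simp add: distrib add_assoc add_left_comm add_closed)
    finally have lower: "?m \<boxplus> ?c = ?c" using ma mb by simp
    show "?c \<in> K"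
      using LS.kernel_convex[OF K m M, of ?c] c lower upper
      by (simp add: subsemifield_of_def)
  qed
qed

text \<open>This justifies defining subkernels through the ambient semifield: restricting to
  \<open>L\<close> keeps exactly the kernels of \<open>S\<close> below \<open>L\<close>.\<close>

lemma kernel_subsemifield_iff:
  assumes "semifield_kernel L S"
  shows "semifield_kernel K (subsemifield_of S L) \<longleftrightarrow> semifield_kernel K S \<and> K \<subseteq> L"
proof
  assume K: "semifield_kernel K (subsemifield_of S L)"
  then interpret K: semifield_kernel K "subsemifield_of S L" .
  show "semifield_kernel K S \<and> K \<subseteq> L"
    using kernel_subsemifieldD[OF K assms] K.subset by (simp add: subsemifield_of_def)
next
  assume "semifield_kernel K S \<and> K \<subseteq> L"
  then show "semifield_kernel K (subsemifield_of S L)"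
    using semifield_kernel_subsemifieldI[OF _ assms] group_axioms by blast
qed

end

section \<open>Homomorphisms and quotients\<close>

lemma semifield_homI:
  assumes "\<And>x. x \<in> carrier S \<Longrightarrow> h x \<in> carrier T"
    and "\<And>x y. \<lbrakk>x \<in> carrier S; y \<in> carrier S\<rbrakk> \<Longrightarrow> h (x \<otimes>\<^bsub>S\<^esub> y) = h x \<otimes>\<^bsub>T\<^esub> h y"
    and "\<And>x y. \<lbrakk>x \<in> carrier S; y \<in> carrier S\<rbrakk> \<Longrightarrow> h (x \<boxplus>\<^bsub>S\<^esub> y) = h x \<boxplus>\<^bsub>T\<^esub> h y"
  shows "h \<in> semifield_hom S T"
  using assms by (auto simp: semifield_hom_def hom_def)

lemma semifield_homD:
  assumes "h \<in> semifield_hom S T"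
  shows "x \<in> carrier S \<Longrightarrow> h x \<in> carrier T"
    and "\<lbrakk>x \<in> carrier S; y \<in> carrier S\<rbrakk> \<Longrightarrow> h (x \<otimes>\<^bsub>S\<^esub> y) = h x \<otimes>\<^bsub>T\<^esub> h y"
    and "\<lbrakk>x \<in> carrier S; y \<in> carrier S\<rbrakk> \<Longrightarrow> h (x \<boxplus>\<^bsub>S\<^esub> y) = h x \<boxplus>\<^bsub>T\<^esub> h y"
  using assms by (auto simp: semifield_hom_def hom_def)

text \<open>Equations pass to a surjective image. No axioms are given for \<open>T\<close>, so its
  unit has to be tied to that of \<open>S\<close> by \<open>one\<close>.\<close>

lemma idempotent_semifield_image:
  assumes S: "idempotent_semifield S" and h: "h \<in> semifield_hom S T"
    and surj: "h ` carrier S = carrier T" and one: "h \<one>\<^bsub>S\<^esub> = \<one>\<^bsub>T\<^esub>"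
  shows "idempotent_semifield T"
proof -
  interpret idempotent_semifield S by fact
  note hD = semifield_homD(2,3)[OF h, symmetric]
  have inv_ex: "\<exists>y\<in>carrier T. y \<otimes>\<^bsub>T\<^esub> x = \<one>\<^bsub>T\<^esub>" if x: "x \<in> carrier T" for x
  proof -
    obtain a where a: "a \<in> carrier S" "x = h a" using x unfolding surj[symmetric] by auto
    then have "h (inv\<^bsub>S\<^esub> a) \<otimes>\<^bsub>T\<^esub> x = \<one>\<^bsub>T\<^esub>" by (simp add: hD one)
    then show ?thesis using a surj by (intro bexI[of _ "h (inv\<^bsub>S\<^esub> a)"]) auto
  qed
  interpret T: comm_group T
    by (rule comm_groupI)
      (use inv_ex in \<open>auto simp: surj[symmetric] hD one[symmetric] m_ac\<close>)
  show ?thesis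
    by unfold_locales
      (auto simp: surj[symmetric] hD add_closed add_assoc add_comm add_left_comm add_idem distrib)
qed

context semifield
begin

lemma coset_hom:
  assumes K: "semifield_kernel K S"
  shows "(#>) K \<in> semifield_hom S (quotient_semifield S K)"
    and "(#>) K ` carrier S = carrier (quotient_semifield S K)"
    and "K #> \<one> = \<one>\<^bsub>quotient_semifield S K\<^esub>"
proof -
  interpret K: semifield_kernel K S by fact
  interpret N: normal K S by (rule subgroup_imp_normal[OF K.is_subgroup])
  show "(#>) K \<in> semifield_hom S (quotient_semifield S K)"
  proof (rule semifield_homI)
    fix x y assume x: "x \<in> carrier S" and y: "y \<in> carrier S"
    show "K #> x \<otimes> y = (K #> x) \<otimes>\<^bsub>quotient_semifield S K\<^esub> (K #> y)"
      using x y by (simp add: quotient_semifield_def N.rcos_sum)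
    \<comment> \<open>One inclusion is distributivity; for the converse,
      \<open>kernel_combination\<close> pulls a single element of \<open>K\<close> out of a sum of
      representatives.\<close>
    have "K #> (x \<boxplus> y) = (\<Union>a\<in>K #> x. \<Union>b\<in>K #> y. {a \<boxplus> b})" (is "?l = ?r")
    proof
      have "k \<otimes> (x \<boxplus> y) \<in> ?r" if "k \<in> K" for k
        using that x y K.subset by (auto simp: r_coset_def distrib)
      then show "?l \<subseteq> ?r" by (auto simp: r_coset_def[of S K "x \<boxplus> y"])
      show "?r \<subseteq> ?l"
      proof clarsimp
        fix a b assume "a \<in> K #> x" "b \<in> K #> y"
        then obtain k k' where k: "k \<in> K" "k' \<in> K" "a = k \<otimes> x" "b = k' \<otimes> y"
          by (auto simp: r_coset_def)
        moreover have "k \<in> carrier S" "k' \<in> carrier S" using k K.subset by auto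
        ultimately show "a \<boxplus> b \<in> K #> x \<boxplus> y"
          using x y kernel_combination[OF K k(1,2) x y]
          by (auto simp: r_coset_def m_comm[of k] m_comm[of k'])
      qed
    qed
    then show "K #> x \<boxplus> y = (K #> x) \<boxplus>\<^bsub>quotient_semifield S K\<^esub> (K #> y)"
      by (simp add: quotient_semifield_def)
  qed (auto simp: quotient_semifield_def RCOSETS_def)
  show "(#>) K ` carrier S = carrier (quotient_semifield S K)"
    by (auto simp: quotient_semifield_def RCOSETS_def)
  show "K #> \<one> = \<one>\<^bsub>quotient_semifield S K\<^esub>"
    using K.subset by (simp add: quotient_semifield_def)
qed

end

lemma (in idempotent_semifield) quotient_idempotent_semifield:
  assumes "semifield_kernel K S"
  shows "idempotent_semifield (quotient_semifield S K)"
  by (rule idempotent_semifield_image[OF idempotent_semifield_axioms coset_hom[OF assms]])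

section \<open>The correspondence theorem and the first isomorphism theorem\<close>

text \<open>The order-theoretic form of a simple factor. Strictness excludes the trivial quotient,
  which \<open>simple_semifield\<close> admits.\<close>

definition covers :: "('a, 'm) semifield_scheme \<Rightarrow> 'a set \<Rightarrow> 'a set \<Rightarrow> bool" where
  "covers S A B \<longleftrightarrow> semifield_kernel A S \<and> semifield_kernel B S \<and> B \<subset> A \<and>
    (\<forall>K. semifield_kernel K S \<and> B \<subseteq> K \<and> K \<subseteq> A \<longrightarrow> K = B \<or> K = A)"

text \<open>Working with any surjective homomorphism lets one set of results serve for the
  projections onto quotients, for their restrictions in the second isomorphism theorem, and for
  arbitrary homomorphic images.\<close>

locale semifield_epi = S: idempotent_semifield S + T: semifield T
  for S :: "('a, 'm) semifield_scheme" and T :: "('b, 'n) semifield_scheme" +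
  fixes h
  assumes h: "h \<in> semifield_hom S T" and surj: "h ` carrier S = carrier T"
begin

definition hker :: "'a set" where
  "hker = {x \<in> carrier S. h x = \<one>\<^bsub>T\<^esub>}"

lemmas h_closed = semifield_homD(1)[OF h]
  and h_mult = semifield_homD(2)[OF h]
  and h_add = semifield_homD(3)[OF h]

sublocale group_hom S T h
  using h by unfold_locales (simp add: semifield_hom_def)

lemma preimage_kernel:
  assumes M: "semifield_kernel M T"
  shows "semifield_kernel {x \<in> carrier S. h x \<in> M} S"
proof -
  interpret M: semifield_kernel M T by fact
  show ?thesis
  proof unfold_locales
    fix a b x y
    assume a: "a \<in> {x \<in> carrier S. h x \<in> M}" "b \<in> {x \<in> carrier S. h x \<in> M}"
      and x: "x \<in> carrier S" "y \<in> carrier S" "x \<boxplus>\<^bsub>S\<^esub> y = \<one>\<^bsub>S\<^esub>"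
    then have "h x \<boxplus>\<^bsub>T\<^esub> h y = \<one>\<^bsub>T\<^esub>" by (metis h_add hom_one)
    then have "(h x \<otimes>\<^bsub>T\<^esub> h a) \<boxplus>\<^bsub>T\<^esub> (h y \<otimes>\<^bsub>T\<^esub> h b) \<in> M"
      using a x by (intro M.convex_comb) auto
    then show "(x \<otimes>\<^bsub>S\<^esub> a) \<boxplus>\<^bsub>S\<^esub> (y \<otimes>\<^bsub>S\<^esub> b) \<in> {x \<in> carrier S. h x \<in> M}"
      using a x by (simp add: h_add S.add_closed)
  qed auto
qed

lemma kernel_hker: "semifield_kernel hker S"
proof -
  have "semifield_kernel {\<one>\<^bsub>T\<^esub>} T"
    by unfold_locales auto
  from preimage_kernel[OF this] show ?thesis by (simp add: hker_def)
qed

text \<open>Coefficients adding up to one in \<open>T\<close> lift to elements whose sum is only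
  mapped to one. So \<open>kernel_combination\<close> is used upstairs, and its extra factor
  \<open>u \<boxplus> v\<close> disappears under \<open>h\<close>.\<close>

lemma image_kernel:
  assumes X: "semifield_kernel X S"
  shows "semifield_kernel (h ` X) T"
proof -
  interpret X: semifield_kernel X S by fact
  interpret hX: subgroup "h ` X" T
    by (rule subgroup_img_is_subgroup[OF X.is_subgroup])
  show ?thesis
  proof unfold_locales
    fix a b x y
    assume ab: "a \<in> h ` X" "b \<in> h ` X"
      and x: "x \<in> carrier T" "y \<in> carrier T" and xy: "x \<boxplus>\<^bsub>T\<^esub> y = \<one>\<^bsub>T\<^esub>"
    obtain a' b' where ab': "a' \<in> X" "b' \<in> X" "a = h a'" "b = h b'" using ab by auto
    obtain u v where uv: "u \<in> carrier S" "v \<in> carrier S" "x = h u" "y = h v"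
      using x surj by (metis imageE)
    obtain k where k: "k \<in> X" "(u \<otimes>\<^bsub>S\<^esub> a') \<boxplus>\<^bsub>S\<^esub> (v \<otimes>\<^bsub>S\<^esub> b') = k \<otimes>\<^bsub>S\<^esub> (u \<boxplus>\<^bsub>S\<^esub> v)"
      by (rule S.kernel_combination[OF X ab'(1,2) uv(1,2)])
    have cl: "a' \<in> carrier S" "b' \<in> carrier S" "k \<in> carrier S" using ab' k X.subset by auto
    have "(x \<otimes>\<^bsub>T\<^esub> a) \<boxplus>\<^bsub>T\<^esub> (y \<otimes>\<^bsub>T\<^esub> b) = h ((u \<otimes>\<^bsub>S\<^esub> a') \<boxplus>\<^bsub>S\<^esub> (v \<otimes>\<^bsub>S\<^esub> b'))"
      using uv ab' cl by (simp add: h_add)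
    also have "\<dots> = h k"
      using k uv cl xy by (simp add: h_add[symmetric] S.add_closed)
    finally show "(x \<otimes>\<^bsub>T\<^esub> a) \<boxplus>\<^bsub>T\<^esub> (y \<otimes>\<^bsub>T\<^esub> b) \<in> h ` X" using k by simp
  qed
qed

text \<open>Together with \<open>image_preimage\<close> this makes the kernels of \<open>T\<close>
  correspond to the kernels of \<open>S\<close> above \<open>hker\<close>.\<close>

lemma preimage_image:
  assumes X: "semifield_kernel X S" and "hker \<subseteq> X"
  shows "{x \<in> carrier S. h x \<in> h ` X} = X"
proof -
  interpret X: semifield_kernel X S by fact
  have "x \<in> X" if x: "x \<in> carrier S" and z: "z \<in> X" "h x = h z" for x z
  proof -
    have zc: "z \<in> carrier S" using z X.subset by auto
    then have "x \<otimes>\<^bsub>S\<^esub> inv\<^bsub>S\<^esub> z \<in> hker"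
      using x z by (simp add: hker_def)
    then have "(x \<otimes>\<^bsub>S\<^esub> inv\<^bsub>S\<^esub> z) \<otimes>\<^bsub>S\<^esub> z \<in> X" using assms(2) z by auto
    then show ?thesis using x zc by (simp add: S.m_assoc)
  qed
  then show ?thesis using X.subset by auto
qed

lemma image_preimage:
  assumes "semifield_kernel M T"
  shows "h ` {x \<in> carrier S. h x \<in> M} = M"
proof -
  interpret M: semifield_kernel M T by fact
  have "M \<subseteq> h ` {x \<in> carrier S. h x \<in> M}"
    using M.subset unfolding surj[symmetric] by blast
  then show ?thesis by blast
qed

lemma image_covers:
  assumes AB: "covers S A B" and ker: "hker \<subseteq> B"
  shows "covers T (h ` A) (h ` B)"
proof -
  have A: "semifield_kernel A S" and B: "semifield_kernel B S" and "B \<subset> A"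
    and max: "\<And>K. \<lbrakk>semifield_kernel K S; B \<subseteq> K; K \<subseteq> A\<rbrakk> \<Longrightarrow> K = B \<or> K = A"
    using AB by (auto simp: covers_def)
  have A': "{x \<in> carrier S. h x \<in> h ` A} = A" and B': "{x \<in> carrier S. h x \<in> h ` B} = B"
    using A B ker \<open>B \<subset> A\<close> by (auto intro!: preimage_image)
  have "M = h ` B \<or> M = h ` A" if M: "semifield_kernel M T" "h ` B \<subseteq> M" "M \<subseteq> h ` A" for M
  proof -
    let ?P = "{x \<in> carrier S. h x \<in> M}"
    have "?P = B \<or> ?P = A"
    proof (rule max[OF preimage_kernel[OF M(1)]])
      show "B \<subseteq> ?P" using B' M(2) by blast
      show "?P \<subseteq> A" using A' M(3) by blast
    qed
    then show ?thesis using image_preimage[OF M(1)] by auto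
  qed
  moreover have "h ` B \<subset> h ` A"
  proof
    show "h ` B \<subseteq> h ` A" using \<open>B \<subset> A\<close> by blast
    show "h ` B \<noteq> h ` A"
    proof
      assume "h ` B = h ` A"
      then have "{x \<in> carrier S. h x \<in> h ` B} = {x \<in> carrier S. h x \<in> h ` A}" by simp
      then show False using A' B' \<open>B \<subset> A\<close> by simp
    qed
  qed
  ultimately show ?thesis
    using image_kernel A B by (auto simp: covers_def)
qed

text \<open>The correspondence sends the trivial kernel of \<open>T\<close> to \<open>hker\<close>
  and all of \<open>T\<close> to all of \<open>S\<close>. The case \<open>hker = carrier S\<close>
  is included, so this is not phrased with \<open>covers\<close>.\<close>

lemma simple_iff:
  "simple_semifield T \<longleftrightarrow>
    (\<forall>X. semifield_kernel X S \<and> hker \<subseteq> X \<longrightarrow> X = hker \<or> X = carrier S)"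
proof
  assume simple: "simple_semifield T"
  show "\<forall>X. semifield_kernel X S \<and> hker \<subseteq> X \<longrightarrow> X = hker \<or> X = carrier S"
  proof (intro allI impI, elim conjE)
    fix X assume X: "semifield_kernel X S" "hker \<subseteq> X"
    then interpret X: semifield_kernel X S by simp
    have "h ` X \<subseteq> carrier T" using X.subset by auto
    then have "h ` X = {\<one>\<^bsub>T\<^esub>} \<or> h ` X = carrier T"
      using simple image_kernel[OF X(1)]
      by (simp add: simple_semifield_def simple_kernel_def)
    then show "X = hker \<or> X = carrier S"
    proof
      assume "h ` X = {\<one>\<^bsub>T\<^esub>}"
      then have "X = hker" using preimage_image[OF X] by (simp add: hker_def)
      then show ?thesis ..
    next
      assume "h ` X = carrier T"
      then have "X = {x \<in> carrier S. h x \<in> carrier T}" using preimage_image[OF X] by simp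
      also have "\<dots> = carrier S" by auto
      finally show ?thesis ..
    qed
  qed
next
  assume max: "\<forall>X. semifield_kernel X S \<and> hker \<subseteq> X \<longrightarrow> X = hker \<or> X = carrier S"
  have "M = {\<one>\<^bsub>T\<^esub>} \<or> M = carrier T" if M: "semifield_kernel M T" for M
  proof -
    interpret M: semifield_kernel M T by fact
    let ?P = "{x \<in> carrier S. h x \<in> M}"
    have "hker \<subseteq> ?P" by (auto simp: hker_def)
    then have "?P = hker \<or> ?P = carrier S" using max preimage_kernel[OF M] by blast
    moreover have "h ` hker = {\<one>\<^bsub>T\<^esub>}"
      by (auto simp: hker_def intro: image_eqI[of _ _ "\<one>\<^bsub>S\<^esub>"])
    ultimately show ?thesis using image_preimage[OF M] surj by auto
  qed
  then show "simple_semifield T"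
    using T.kernel_carrier by (auto simp: simple_semifield_def simple_kernel_def)
qed

lemma isomorphic_quotient: "semifield_isomorphic T (quotient_semifield S hker)"
proof -
  let ?Q = "quotient_semifield S hker"
  \<comment> \<open>The inverse direction sends \<open>t\<close> to its fibre, which is the coset of
    any preimage of \<open>t\<close>. No representative is chosen, and distinct points have disjoint
    nonempty fibres, hence injectivity.\<close>
  define g where "g t = {x \<in> carrier S. h x = t}" for t
  have g: "g (h a) = hker #>\<^bsub>S\<^esub> a" if a: "a \<in> carrier S" for a
  proof
    have "x \<in> hker #>\<^bsub>S\<^esub> a" if "x \<in> carrier S" "h x = h a" for x
      unfolding r_coset_def using that a
      by (auto simp: hker_def S.m_assoc intro!: exI[of _ "x \<otimes>\<^bsub>S\<^esub> inv\<^bsub>S\<^esub> a"])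
    then show "g (h a) \<subseteq> hker #>\<^bsub>S\<^esub> a" by (auto simp: g_def)
    show "hker #>\<^bsub>S\<^esub> a \<subseteq> g (h a)"
      using a by (auto simp: g_def r_coset_def hker_def)
  qed
  note coset = S.coset_hom[OF kernel_hker]
  have "g \<in> semifield_hom T ?Q"
  proof (rule semifield_homI)
    fix t u assume "t \<in> carrier T" "u \<in> carrier T"
    then obtain a b where ab: "a \<in> carrier S" "b \<in> carrier S" "t = h a" "u = h b"
      using surj by (metis imageE)
    have "g (h (a \<otimes>\<^bsub>S\<^esub> b)) = g (h a) \<otimes>\<^bsub>?Q\<^esub> g (h b)"
      using ab g semifield_homD(2)[OF coset(1)] by (simp del: hom_mult)
    then show "g (t \<otimes>\<^bsub>T\<^esub> u) = g t \<otimes>\<^bsub>?Q\<^esub> g u" using ab by simp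
    have "g (h (a \<boxplus>\<^bsub>S\<^esub> b)) = g (h a) \<boxplus>\<^bsub>?Q\<^esub> g (h b)"
      using ab g semifield_homD(3)[OF coset(1)] by (simp add: S.add_closed)
    then show "g (t \<boxplus>\<^bsub>T\<^esub> u) = g t \<boxplus>\<^bsub>?Q\<^esub> g u" using ab by (simp add: h_add)
  qed (use g coset(2) surj in \<open>metis imageE imageI\<close>)
  moreover have "bij_betw g (carrier T) (carrier ?Q)"
    unfolding bij_betw_def
  proof
    show "inj_on g (carrier T)"
    proof (rule inj_onI)
      fix t u assume "t \<in> carrier T" "u \<in> carrier T" and eq: "g t = g u"
      then obtain a where "a \<in> carrier S" "t = h a" using surj by (metis imageE)
      then have "a \<in> g u" using eq by (auto simp: g_def)
      then show "t = u" using \<open>t = h a\<close> by (simp add: g_def)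
    qed
    have "g ` carrier T = (\<lambda>a. g (h a)) ` carrier S" by (simp add: surj[symmetric] image_image)
    also have "\<dots> = carrier ?Q" using g coset(2) by simp
    finally show "g ` carrier T = carrier ?Q" .
  qed
  ultimately show ?thesis by (auto simp: semifield_isomorphic_def)
qed

end

section \<open>Isomorphism as an equivalence relation\<close>

lemma semifield_isomorphic_refl: "semifield_isomorphic X X"
  unfolding semifield_isomorphic_def
  by (rule bexI[of _ id]) (simp, rule semifield_homI, simp_all)

lemma semifield_isomorphic_trans:
  assumes "semifield_isomorphic X Y" "semifield_isomorphic Y Z"
  shows "semifield_isomorphic X Z"
proof -
  obtain f g where f: "f \<in> semifield_hom X Y" "bij_betw f (carrier X) (carrier Y)"
    and g: "g \<in> semifield_hom Y Z" "bij_betw g (carrier Y) (carrier Z)"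
    using assms by (auto simp: semifield_isomorphic_def)
  have "g \<circ> f \<in> semifield_hom X Z"
    by (rule semifield_homI) (simp_all add: semifield_homD[OF f(1)] semifield_homD[OF g(1)])
  then show ?thesis
    using bij_betw_trans[OF f(2) g(2)] by (auto simp: semifield_isomorphic_def)
qed

text \<open>The inverse map is evaluated at images of sums and products, so \<open>X\<close> must be
  closed under its operations; a bare record does not guarantee this.\<close>

lemma semifield_isomorphic_sym:
  assumes "semifield X" "semifield_isomorphic X Y"
  shows "semifield_isomorphic Y X"
proof -
  interpret X: semifield X by fact
  obtain f where f: "f \<in> semifield_hom X Y" and bij: "bij_betw f (carrier X) (carrier Y)"
    using assms by (auto simp: semifield_isomorphic_def)
  let ?g = "inv_into (carrier X) f"
  have g: "?g (f a) = a" if "a \<in> carrier X" for a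
    using bij that by (simp add: bij_betw_inv_into_left)
  have surj: "carrier Y = f ` carrier X" using bij by (simp add: bij_betw_def)
  have "?g \<in> semifield_hom Y X"
    by (rule semifield_homI)
      (auto simp: surj g semifield_homD(2,3)[OF f, symmetric] X.add_closed)
  then show ?thesis
    using bij_betw_inv_into[OF bij] by (auto simp: semifield_isomorphic_def)
qed

section \<open>Factors of chains and the second isomorphism theorem\<close>

lemma r_coset_subsemifield: "r_coset (subsemifield_of S L) K = r_coset S K"
  by (intro ext) (simp add: r_coset_def subsemifield_of_def)

context idempotent_semifield
begin

lemma kernel_quotient_epi:
  assumes L: "semifield_kernel L S" and K: "semifield_kernel K S" and "K \<subseteq> L"
  shows "semifield_epi (subsemifield_of S L) (kernel_quotient S L K) ((#>) K)"
    and "semifield_epi.hker (subsemifield_of S L) (kernel_quotient S L K) ((#>) K) = K"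
proof -
  interpret L: idempotent_semifield "subsemifield_of S L"
    by (rule subsemifield_idempotent_semifield[OF L])
  have K': "semifield_kernel K (subsemifield_of S L)"
    using assms by (simp add: kernel_subsemifield_iff)
  interpret K: semifield_kernel K S by fact
  interpret Q: idempotent_semifield "kernel_quotient S L K"
    unfolding kernel_quotient_def by (rule L.quotient_idempotent_semifield[OF K'])
  show epi: "semifield_epi (subsemifield_of S L) (kernel_quotient S L K) ((#>) K)"
    using L.coset_hom(1,2)[OF K']
    by unfold_locales (simp_all add: kernel_quotient_def r_coset_subsemifield)
  have "{x \<in> L. K #> x = K} = K"
  proof -
    interpret LS: semifield_kernel L S by fact
    have "K #> x = K \<longleftrightarrow> x \<in> K" if "x \<in> L" for x
      using coset_join1[OF _ _ K.is_subgroup, of x] coset_join2[OF _ K.is_subgroup, of x]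
        that LS.subset by auto
    then show ?thesis using \<open>K \<subseteq> L\<close> by auto
  qed
  then show "semifield_epi.hker (subsemifield_of S L) (kernel_quotient S L K) ((#>) K) = K"
    unfolding semifield_epi.hker_def[OF epi]
    by (simp add: kernel_quotient_def quotient_semifield_def subsemifield_of_def)
qed

lemma kernel_quotient_idempotent_semifield:
  assumes L: "semifield_kernel L S" and K: "semifield_kernel K S" and "K \<subseteq> L"
  shows "idempotent_semifield (kernel_quotient S L K)"
  unfolding kernel_quotient_def
  using idempotent_semifield.quotient_idempotent_semifield
    [OF subsemifield_idempotent_semifield[OF L]] assms
  by (simp add: kernel_subsemifield_iff)

text \<open>This is \<open>simple_iff\<close> for the projection of \<open>A\<close> onto its
  quotient by \<open>B\<close>, with kernels of \<open>A\<close> exchanged for kernels of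
  \<open>S\<close> below \<open>A\<close>.\<close>

lemma covers_iff_simple:
  assumes A: "semifield_kernel A S" and B: "semifield_kernel B S" and "B \<subset> A"
  shows "covers S A B \<longleftrightarrow> simple_semifield (kernel_quotient S A B)"
proof -
  have sub: "B \<subseteq> A" using \<open>B \<subset> A\<close> by blast
  show ?thesis
    unfolding semifield_epi.simple_iff[OF kernel_quotient_epi(1)[OF A B sub]]
      kernel_quotient_epi(2)[OF A B sub] kernel_subsemifield_iff[OF A]
    using assms by (auto simp: covers_def subsemifield_of_def)
qed

text \<open>The projection of \<open>A <#> B\<close> modulo \<open>B\<close> remains surjective when
  restricted to \<open>A\<close>, because elements of \<open>B\<close> do not change the coset. The
  restriction has kernel \<open>A \<inter> B\<close>, so the first isomorphism theorem
  applies.\<close>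

theorem second_isomorphism:
  assumes A: "semifield_kernel A S" and B: "semifield_kernel B S"
  shows "semifield_isomorphic (kernel_quotient S (A <#> B) B) (kernel_quotient S A (A \<inter> B))"
proof -
  let ?T = "kernel_quotient S (A <#> B) B"
  note AB = kernel_set_mult[OF A B] and up = kernel_set_mult_upper[OF A B]
  interpret AK: semifield_kernel A S by fact
  interpret BK: semifield_kernel B S by fact
  interpret E: semifield_epi "subsemifield_of S (A <#> B)" ?T "(#>) B"
    by (rule kernel_quotient_epi(1)[OF AB B up(2)])
  have hker: "E.hker = B" by (rule kernel_quotient_epi(2)[OF AB B up(2)])
  interpret SA: idempotent_semifield "subsemifield_of S A"
    by (rule subsemifield_idempotent_semifield[OF A])
  have hom: "(#>) B \<in> semifield_hom (subsemifield_of S A) ?T"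
    using semifield_homD[OF E.h] up(1)
    by (intro semifield_homI) (auto simp: subsemifield_of_def subset_eq)
  have surj: "(#>) B ` carrier (subsemifield_of S A) = carrier ?T"
  proof -
    have "B #> (a \<otimes> b) = B #> a" if "a \<in> A" "b \<in> B" for a b
    proof -
      have "a \<in> carrier S" "b \<in> carrier S" using that AK.subset BK.subset by auto
      then have "B #> (a \<otimes> b) = (B #> b) #> a"
        using BK.subset by (simp add: coset_mult_assoc m_comm)
      also have "B #> b = B" using that \<open>b \<in> carrier S\<close> BK.is_subgroup by (simp add: coset_join2)
      finally show ?thesis .
    qed
    then have "(#>) B ` (A <#> B) \<subseteq> (#>) B ` A" by (auto simp: set_mult_def)
    then show ?thesis
      using up(1) unfolding E.surj[symmetric] by (auto simp: subsemifield_of_def)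
  qed
  interpret F: semifield_epi "subsemifield_of S A" ?T "(#>) B"
    using hom surj by unfold_locales
  have "F.hker = A \<inter> E.hker"
    unfolding F.hker_def E.hker_def using up(1) by (auto simp: subsemifield_of_def)
  then show ?thesis
    using F.isomorphic_quotient hker by (simp add: kernel_quotient_def)
qed

end

section \<open>Isomorphism classes of factors and transposed covers\<close>

text \<open>Replacing a factor by the set of all records isomorphic to it turns isomorphism into
  equality, so factors up to reordering can be compared as multisets.\<close>

definition factor_class ::
    "('a, 'm) semifield_scheme \<Rightarrow> 'a set \<Rightarrow> 'a set \<Rightarrow> 'a set semifield set" where
  "factor_class S A B = {Y. semifield_isomorphic (kernel_quotient S A B) Y}"

lemma factor_class_eqD:
  assumes "factor_class S A B = factor_class S C D"
  shows "semifield_isomorphic (kernel_quotient S A B) (kernel_quotient S C D)"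
  using assms semifield_isomorphic_refl[of "kernel_quotient S C D"] by (auto simp: factor_class_def)

context idempotent_semifield
begin

lemma factor_class_set_mult:
  assumes A: "semifield_kernel A S" and B: "semifield_kernel B S"
  shows "factor_class S (A <#> B) B = factor_class S A (A \<inter> B)"
proof -
  have "semifield (kernel_quotient S (A <#> B) B)"
    using kernel_quotient_idempotent_semifield[OF kernel_set_mult[OF A B] B]
      kernel_set_mult_upper(2)[OF A B]
    by (simp add: idempotent_semifield_def)
  then show ?thesis
    using second_isomorphism[OF A B] semifield_isomorphic_sym semifield_isomorphic_trans
    unfolding factor_class_def by blast
qed

text \<open>One half of the transposition principle of modular lattices: \<open>X\<close> between
  \<open>A \<inter> B\<close> and \<open>A\<close> is sent to \<open>X <#> B\<close>, and the
  modular law recovers \<open>X\<close> from it.\<close>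

lemma covers_Int:
  assumes A: "semifield_kernel A S" and B: "semifield_kernel B S" and cov: "covers S (A <#> B) B"
  shows "covers S A (A \<inter> B)"
proof -
  have max: "\<And>K. \<lbrakk>semifield_kernel K S; B \<subseteq> K; K \<subseteq> A <#> B\<rbrakk> \<Longrightarrow> K = B \<or> K = A <#> B"
    and ne: "A <#> B \<noteq> B"
    using cov by (auto simp: covers_def)
  have "\<not> A \<subseteq> B"
    using ne kernel_set_mult_least[OF B, of A B] kernel_set_mult_upper[OF A B] by auto
  moreover have "X = A \<inter> B \<or> X = A"
    if X: "semifield_kernel X S" and sub: "A \<inter> B \<subseteq> X" "X \<subseteq> A" for X
  proof -
    note up = kernel_set_mult_upper[OF X B]
    have "X <#> B \<subseteq> A <#> B" using sub by (auto simp: set_mult_def)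
    with max[OF kernel_set_mult[OF X B] up(2)] have "X <#> B = B \<or> X <#> B = A <#> B" .
    then show ?thesis
    proof
      assume "X <#> B = B"
      then show ?thesis using up sub by auto
    next
      assume "X <#> B = A <#> B"
      then have "A \<subseteq> A \<inter> (X <#> B)" using kernel_set_mult_upper[OF A B] by auto
      also have "\<dots> \<subseteq> X <#> (A \<inter> B)" by (rule kernel_modular[OF A B X sub(2)])
      also have "\<dots> \<subseteq> X" by (rule kernel_set_mult_least[OF X _ sub(1)]) simp
      finally show ?thesis using sub by auto
    qed
  qed
  ultimately show ?thesis
    using A B kernel_Int by (auto simp: covers_def)
qed

text \<open>The other half: \<open>X\<close> between \<open>B\<close> and \<open>A <#> B\<close> is
  sent to \<open>A \<inter> X\<close>, and the modular law recovers \<open>X\<close> as the product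
  of \<open>B\<close> with that intersection.\<close>

lemma covers_set_mult:
  assumes A: "semifield_kernel A S" and B: "semifield_kernel B S" and cov: "covers S A (A \<inter> B)"
  shows "covers S (A <#> B) B"
proof -
  have max: "\<And>K. \<lbrakk>semifield_kernel K S; A \<inter> B \<subseteq> K; K \<subseteq> A\<rbrakk> \<Longrightarrow> K = A \<inter> B \<or> K = A"
    and ne: "\<not> A \<subseteq> B"
    using cov by (auto simp: covers_def)
  note up = kernel_set_mult_upper[OF A B]
  have "X = B \<or> X = A <#> B"
    if X: "semifield_kernel X S" and sub: "B \<subseteq> X" "X \<subseteq> A <#> B" for X
  proof -
    \<comment> \<open>\<open>kernel_modular\<close> expects the kernel contained in
      \<open>X\<close>, here \<open>B\<close>, as the left factor.\<close>
    have "X \<inter> (A <#> B) = X \<inter> (B <#> A)"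
      by (simp add: kernel_set_mult_commute[OF A B])
    have "A \<inter> X = A \<inter> B \<or> A \<inter> X = A"
      using max[OF kernel_Int[OF A X]] sub by auto
    then show ?thesis
    proof
      assume eq: "A \<inter> X = A \<inter> B"
      have "X \<subseteq> X \<inter> (B <#> A)" using sub \<open>X \<inter> (A <#> B) = X \<inter> (B <#> A)\<close> by auto
      also have "\<dots> \<subseteq> B <#> (X \<inter> A)" by (rule kernel_modular[OF X A B sub(1)])
      also have "\<dots> \<subseteq> B" using eq by (intro kernel_set_mult_least[OF B]) auto
      finally show ?thesis using sub by auto
    next
      assume "A \<inter> X = A"
      then have "A <#> B \<subseteq> X" using sub by (intro kernel_set_mult_least[OF X]) auto
      then show ?thesis using sub by auto
    qed
  qed
  moreover have "B \<subset> A <#> B" using up ne by auto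
  ultimately show ?thesis
    using kernel_set_mult[OF A B] B by (auto simp: covers_def)
qed

end

section \<open>The Jordan-Hoelder argument\<close>

text \<open>The starting kernel is kept out of the list, so consecutive paths join by
  \<open>@\<close> without repeating the kernel where they meet.\<close>

primrec cover_path ::
    "('a, 'm) semifield_scheme \<Rightarrow> 'a set \<Rightarrow> 'a set list \<Rightarrow> 'a set \<Rightarrow> bool" where
  "cover_path S A [] B \<longleftrightarrow> A = B"
| "cover_path S A (X # Xs) B \<longleftrightarrow> covers S A X \<and> cover_path S X Xs B"

primrec factors ::
    "('a, 'm) semifield_scheme \<Rightarrow> 'a set \<Rightarrow> 'a set list \<Rightarrow> 'a set semifield set list" where
  "factors S A [] = []"
| "factors S A (X # Xs) = factor_class S A X # factors S X Xs"

lemma length_factors: "length (factors S A Xs) = length Xs"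
  by (induction Xs arbitrary: A) auto

lemma factors_nth:
  "i < length Xs \<Longrightarrow> factors S A Xs ! i = factor_class S ((A # Xs) ! i) ((A # Xs) ! Suc i)"
  by (induction Xs arbitrary: A i) (auto simp: nth_Cons split: nat.split)

lemma cover_path_append:
  "cover_path S A Xs B \<Longrightarrow> cover_path S B Ys C \<Longrightarrow> cover_path S A (Xs @ Ys) C"
  by (induction Xs arbitrary: A) auto

lemma factors_append:
  "cover_path S A Xs B \<Longrightarrow> factors S A (Xs @ Ys) = factors S A Xs @ factors S B Ys"
  by (induction Xs arbitrary: A) auto

lemma cover_path_subset: "cover_path S A Xs B \<Longrightarrow> B \<subseteq> A"
  by (induction Xs arbitrary: A) (auto simp: covers_def)

lemma cover_path_last: "cover_path S A Xs B \<Longrightarrow> last (A # Xs) = B"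
  by (induction Xs arbitrary: A) auto

lemma cover_path_same: "cover_path S A Xs A \<Longrightarrow> Xs = []"
  using cover_path_subset by (cases Xs) (fastforce simp: covers_def)+

lemma cover_path_covers:
  assumes "cover_path S A Xs B" "covers S A B"
  shows "Xs = [B]"
proof (cases Xs)
  case Nil
  then show ?thesis using assms by (auto simp: covers_def)
next
  case (Cons X Ys)
  then have "B \<subseteq> X" "covers S A X" using assms cover_path_subset[of S X Ys B] by auto
  then have "X = B" using assms(2) by (auto simp: covers_def)
  then show ?thesis using assms Cons by (auto dest: cover_path_same)
qed

text \<open>Equal multisets yield a bijection of positions matching equal classes, and equal classes
  mean isomorphic factors.\<close>

lemma equivalent_chainsI:
  assumes "mset (factors S A Xs) = mset (factors S B Ys)"
  shows "equivalent_chains S (A # Xs) (B # Ys)"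
proof -
  obtain f where f: "bij_betw f {..<length Xs} {..<length Ys}"
    "\<And>i. i < length Xs \<Longrightarrow> factors S A Xs ! i = factors S B Ys ! f i"
    using permutation_Ex_bij[OF assms] by (auto simp: length_factors)
  have "f i < length Ys" if "i < length Xs" for i
    using f(1) that by (auto simp: bij_betw_def)
  then show ?thesis
    unfolding equivalent_chains_def chain_factor_def chain_length_def
    using f by (auto intro!: exI[of _ f] factor_class_eqD simp: factors_nth)
qed

section \<open>Rerouting a path through a prescribed kernel\<close>

context idempotent_semifield
begin

text \<open>Each step from \<open>X\<close> to \<open>Y\<close> is transposed to the step from
  \<open>X <#> K\<close> to \<open>Y <#> K\<close>, which is again a cover and has the same factor
  class.\<close>

lemma cover_path_set_mult:
  assumes "cover_path S X Xs D" and "semifield_kernel X S" and K: "semifield_kernel K S"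
    and "D \<subseteq> K" "X \<inter> K \<subseteq> D"
  shows "cover_path S (X <#> K) (map (\<lambda>Y. Y <#> K) Xs) (D <#> K)
    \<and> factors S (X <#> K) (map (\<lambda>Y. Y <#> K) Xs) = factors S X Xs"
  using assms(1,2,5)
proof (induction Xs arbitrary: X)
  case (Cons Y Xs)
  have XY: "covers S X Y" and path: "cover_path S Y Xs D" and X: "semifield_kernel X S"
    using Cons.prems by auto
  then have Y: "semifield_kernel Y S" and "Y \<subseteq> X" by (auto simp: covers_def)
  have DY: "D \<subseteq> Y" using cover_path_subset[OF path] .
  note YK = kernel_set_mult[OF Y K] and up = kernel_set_mult_upper[OF Y K]
  \<comment> \<open>The transposition requires \<open>Y\<close> to be the meet of \<open>X\<close>
    and \<open>Y <#> K\<close>. By the modular law this holds because \<open>X \<inter> K\<close> is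
    below \<open>D\<close>, hence below \<open>Y\<close>.\<close>
  have int: "X \<inter> (Y <#> K) = Y"
  proof
    have "X \<inter> (Y <#> K) \<subseteq> Y <#> (X \<inter> K)" by (rule kernel_modular[OF X K Y \<open>Y \<subseteq> X\<close>])
    also have "\<dots> \<subseteq> Y" using DY Cons.prems(3) by (intro kernel_set_mult_least[OF Y]) auto
    finally show "X \<inter> (Y <#> K) \<subseteq> Y" .
    show "Y \<subseteq> X \<inter> (Y <#> K)" using up \<open>Y \<subseteq> X\<close> by auto
  qed
  have prod: "X <#> (Y <#> K) = X <#> K"
  proof
    note XK = kernel_set_mult_upper[OF X K]
    show "X <#> (Y <#> K) \<subseteq> X <#> K"
      using XK \<open>Y \<subseteq> X\<close> by (intro kernel_set_mult_least kernel_set_mult X Y K) auto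
    show "X <#> K \<subseteq> X <#> (Y <#> K)"
      using up by (auto simp: set_mult_def[of S X])
  qed
  have "covers S (X <#> K) (Y <#> K)"
    using covers_set_mult[OF X YK] XY int prod by simp
  moreover have "factor_class S (X <#> K) (Y <#> K) = factor_class S X Y"
    using factor_class_set_mult[OF X YK] int prod by simp
  ultimately show ?case
    using Cons.IH[OF path Y] Cons.prems(3) \<open>Y \<subseteq> X\<close> by auto
qed simp

text \<open>Refinement, uniqueness and additivity of length all follow from this multiset
  identity.\<close>

theorem cover_path_through:
  assumes "cover_path S L cs {\<one>}" and "semifield_kernel K S" and "K \<subseteq> L"
  shows "\<exists>us vs. cover_path S L us K \<and> cover_path S K vs {\<one>} \<and>
    mset (factors S L us) + mset (factors S K vs) = mset (factors S L cs)"
  using assms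
proof (induction cs arbitrary: L K)
  case Nil
  interpret K: semifield_kernel K S by (rule Nil.prems)
  have "K = {\<one>}" "L = {\<one>}" using Nil.prems K.one_closed by auto
  then show ?case by (intro exI[of _ "[]"]) simp
next
  case (Cons X cs)
  have LX: "covers S L X" and path: "cover_path S X cs {\<one>}" using Cons.prems by auto
  have L: "semifield_kernel L S" and X: "semifield_kernel X S" and "X \<subseteq> L"
    and max: "\<And>K. \<lbrakk>semifield_kernel K S; X \<subseteq> K; K \<subseteq> L\<rbrakk> \<Longrightarrow> K = X \<or> K = L"
    using LX by (auto simp: covers_def)
  have K: "semifield_kernel K S" using Cons.prems by simp
  show ?case
  proof (cases "K \<subseteq> X")
    case True
    from Cons.IH[OF path K True] obtain us vs
      where "cover_path S X us K" "cover_path S K vs {\<one>}"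
        "mset (factors S X us) + mset (factors S K vs) = mset (factors S X cs)" by blast
    then show ?thesis using LX by (intro exI[of _ "X # us"] exI[of _ vs]) simp
  next
    case False
    let ?D = "K \<inter> X"
    \<comment> \<open>The product lies between \<open>X\<close> and \<open>L\<close> and is not
      \<open>X\<close>, since it contains \<open>K\<close>.\<close>
    have prod: "K <#> X = L"
      using max[OF kernel_set_mult[OF K X]] kernel_set_mult_upper[OF K X] False
        kernel_set_mult_least[OF L Cons.prems(3) \<open>X \<subseteq> L\<close>] by auto
    have D: "semifield_kernel ?D S" by (rule kernel_Int[OF K X])
    have KD: "covers S K ?D" using covers_Int[OF K X] LX prod by simp
    have fKD: "factor_class S K ?D = factor_class S L X"
      using factor_class_set_mult[OF K X] prod by simp
    from Cons.IH[OF path D] obtain us vs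
      where us: "cover_path S X us ?D" and vs: "cover_path S ?D vs {\<one>}"
        and f: "mset (factors S X us) + mset (factors S ?D vs) = mset (factors S X cs)" by blast
    have "X <#> K = L"
      using prod kernel_set_mult_commute[OF K X] by simp
    moreover have "?D <#> K = K"
      using kernel_set_mult_least[OF K, of ?D K] kernel_set_mult_upper(2)[OF D K] by auto
    ultimately have "cover_path S L (map (\<lambda>Y. Y <#> K) us) K
        \<and> factors S L (map (\<lambda>Y. Y <#> K) us) = factors S X us"
      using cover_path_set_mult[OF us X K] by auto
    \<comment> \<open>The transported path from \<open>L\<close> to \<open>K\<close> carries the
      factors of \<open>us\<close>. The factor of \<open>L\<close> by \<open>X\<close>, missing
      there, reappears as that of \<open>K\<close> by \<open>?D\<close> at the head of the path
      below \<open>K\<close>.\<close>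
    then show ?thesis
      using KD vs f fKD by (intro exI[of _ "map (\<lambda>Y. Y <#> K) us"] exI[of _ "?D # vs"]) simp
  qed
qed

text \<open>The path is rerouted through the first prescribed kernel \<open>K\<close>, and the
  recursion continues with the part below \<open>K\<close>.\<close>

lemma cover_path_refine:
  assumes "cover_path S L cs {\<one>}" and "\<forall>K\<in>set ks. semifield_kernel K S"
    and "sorted_wrt (\<supset>) (L # ks)"
  shows "\<exists>ms. cover_path S L ms {\<one>} \<and> mset (factors S L ms) = mset (factors S L cs)
    \<and> subseq ks ms"
  using assms
proof (induction ks arbitrary: L cs)
  case (Cons K ks)
  have K: "semifield_kernel K S" and "K \<subset> L" using Cons.prems by auto
  obtain us vs where us: "cover_path S L us K" and vs: "cover_path S K vs {\<one>}"
    and f: "mset (factors S L us) + mset (factors S K vs) = mset (factors S L cs)"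
    using cover_path_through[OF Cons.prems(1) K] \<open>K \<subset> L\<close> by auto
  obtain ms where ms: "cover_path S K ms {\<one>}" "mset (factors S K ms) = mset (factors S K vs)"
    "subseq ks ms"
    using Cons.IH[OF vs] Cons.prems by auto
  \<comment> \<open>Because \<open>K\<close> is strictly below \<open>L\<close>, the path
    \<open>us\<close> is nonempty and lists \<open>K\<close> as its last entry, so \<open>K\<close>
    occurs in the refined list.\<close>
  have "us \<noteq> []" using us \<open>K \<subset> L\<close> by auto
  then obtain us' where us': "us = us' @ [K]"
    using cover_path_last[OF us] by (cases us rule: rev_cases) auto
  have "subseq (K # ks) (us @ ms)"
    using ms(3) us' by (simp add: subseq_append_le_same_iff list_emb_append2)
  then show ?case
    using cover_path_append[OF us ms(1)] factors_append[OF us] f ms(2)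
    by (intro exI[of _ "us @ ms"]) simp
qed auto

text \<open>Rerouting \<open>cs\<close> through the first kernel \<open>K\<close> of the other path
  leaves only the single step from \<open>L\<close> to \<open>K\<close> above it, as
  \<open>L\<close> covers \<open>K\<close>; the parts below \<open>K\<close> agree by
  induction.\<close>

lemma cover_path_unique:
  assumes "cover_path S L cs {\<one>}" "cover_path S L ks {\<one>}"
  shows "mset (factors S L cs) = mset (factors S L ks)"
  using assms
proof (induction ks arbitrary: L cs)
  case Nil
  then show ?case by (auto dest: cover_path_same)
next
  case (Cons K ks)
  have cov: "covers S L K" and K: "semifield_kernel K S" "K \<subseteq> L"
    using Cons.prems by (auto simp: covers_def)
  obtain us vs where us: "cover_path S L us K" and vs: "cover_path S K vs {\<one>}"
    and f: "mset (factors S L us) + mset (factors S K vs) = mset (factors S L cs)"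
    using cover_path_through[OF Cons.prems(1) K] by auto
  have "us = [K]" by (rule cover_path_covers[OF us cov])
  then show ?case using f Cons.IH[OF vs] Cons.prems by auto
qed

section \<open>Translation between paths and composition series\<close>

lemma cover_path_iff:
  assumes "semifield_kernel L S"
  shows "cover_path S L ks B \<longleftrightarrow> (\<forall>K\<in>set ks. semifield_kernel K S) \<and> sorted_wrt (\<supset>) (L # ks) \<and>
    last (L # ks) = B \<and> (\<forall>i<length ks. simple_semifield (chain_factor S (L # ks) i))"
  using assms
proof (induction ks arbitrary: L)
  case (Cons K ks)
  \<comment> \<open>Covers relate neighbours only, while \<open>sorted_wrt\<close> compares all
    pairs; transitivity bridges the two.\<close>
  have trans: "transp ((\<supset>) :: 'a set \<Rightarrow> _)" by (auto intro: transpI)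
  have "covers S L K \<longleftrightarrow> semifield_kernel K S \<and> K \<subset> L \<and> simple_semifield (kernel_quotient S L K)"
    using covers_iff_simple[OF Cons.prems] by (auto simp: covers_def)
  then show ?case
    using Cons.IH[of K] sorted_wrt2[OF trans, of L K ks]
    by (auto simp: All_less_Suc2 chain_factor_def simp del: sorted_wrt.simps)
qed simp

lemma composition_series_iff:
  assumes "semifield_kernel L S"
  shows "composition_series S L Ks \<longleftrightarrow> (\<exists>cs. Ks = L # cs \<and> cover_path S L cs {\<one>})"
proof (cases Ks)
  case Nil
  then show ?thesis by (simp add: composition_series_def subkernel_chain_def)
next
  case (Cons K ks)
  then show ?thesis
    using assms
    by (auto simp: composition_series_def subkernel_chain_def subkernel_def chain_length_def
        cover_path_iff)
qed

text \<open>Uniqueness of the multiset of factors fixes the length, so the definite description is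
  well defined.\<close>

lemma kernel_length_eq:
  assumes L: "semifield_kernel L S" and cs: "cover_path S L cs {\<one>}"
  shows "kernel_length S L = length cs"
  unfolding kernel_length_def
proof (rule the_equality)
  show "\<exists>Ks. composition_series S L Ks \<and> chain_length Ks = length cs"
    using cs by (auto simp: composition_series_iff[OF L] chain_length_def)
  fix n assume "\<exists>Ks. composition_series S L Ks \<and> chain_length Ks = n"
  then obtain ks where ks: "cover_path S L ks {\<one>}" "n = length ks"
    by (auto simp: composition_series_iff[OF L] chain_length_def)
  from mset_eq_length[OF cover_path_unique[OF cs ks(1)]] ks(2)
  show "n = length cs" by (simp add: length_factors)
qed

lemma cover_path_subsemifield:
  assumes L: "semifield_kernel L S" and "cover_path S A Xs B" and "A \<subseteq> L"
  shows "cover_path (subsemifield_of S L) A Xs B"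
  using assms(2,3)
proof (induction Xs arbitrary: A)
  case (Cons X Xs)
  then have "covers (subsemifield_of S L) A X" "X \<subseteq> L"
    by (auto simp: covers_def kernel_subsemifield_iff[OF L])
  then show ?case using Cons by simp
qed simp

end

section \<open>Composition series of homomorphic images\<close>

lemma (in semifield_epi) cover_path_image:
  assumes "cover_path S A Xs B" "hker \<subseteq> B"
  shows "cover_path T (h ` A) (map ((`) h) Xs) (h ` B)"
  using assms
proof (induction Xs arbitrary: A)
  case (Cons X Xs)
  then have "hker \<subseteq> X" using cover_path_subset[of S X Xs B] by auto
  then show ?case using Cons image_covers by auto
qed simp

text \<open>The part of a series of \<open>L\<close> lying above the kernel of \<open>h\<close> maps
  to a composition series of the image.\<close>

lemma (in idempotent_semifield) epi_cover_path:
  assumes L: "semifield_kernel L S"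
    and epi: "semifield_epi (subsemifield_of S L) T h"
    and us: "cover_path S L us (semifield_epi.hker (subsemifield_of S L) T h)"
  shows "cover_path T (carrier T) (map ((`) h) us) {\<one>\<^bsub>T\<^esub>}"
proof -
  interpret E: semifield_epi "subsemifield_of S L" T h by fact
  have "h ` E.hker = {\<one>\<^bsub>T\<^esub>}"
    using E.hom_one E.S.one_closed by (force simp: E.hker_def)
  then show ?thesis
    using E.cover_path_image[OF cover_path_subsemifield[OF L us order_refl] order_refl] E.surj
    by (simp add: subsemifield_of_def)
qed

theorem theorem0p12p0p8:
  fixes S :: "('a, 'm) semifield_scheme" and L :: "'a set" and Cs :: "'a set list"
  assumes "idempotent_semifield S"
    and "semifield_kernel L S"
    and "composition_series S L Cs"
  shows
    "(\<forall>Ks. subkernel_chain S L Ks \<longrightarrow>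
        (\<exists>Ms. chain_refinement S L Ks Ms \<and> composition_series S L Ms \<and> equivalent_chains S Ms Cs) \<and>
        chain_length Ks \<le> chain_length Cs)
   \<and> (\<forall>Ks Ms. composition_series S L Ks \<and> composition_series S L Ms \<longrightarrow> equivalent_chains S Ks Ms)
   \<and> (\<forall>K. subkernel S L K \<longrightarrow>
        has_composition_series S K \<and>
        has_composition_series (kernel_quotient S L K) (carrier (kernel_quotient S L K)) \<and>
        kernel_length S L =
          kernel_length S K + kernel_length (kernel_quotient S L K) (carrier (kernel_quotient S L K)))
   \<and> (\<forall>(T :: ('b, 'n) semifield_scheme) h.
        semifield T \<and> h \<in> semifield_hom (subsemifield_of S L) T \<longrightarrow>
        has_composition_series (subsemifield_of T (h ` L)) (h ` L))"
proof -
  interpret idempotent_semifield S by fact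
  note L = \<open>semifield_kernel L S\<close>
  obtain cs where Cs: "Cs = L # cs" and cs: "cover_path S L cs {\<one>\<^bsub>S\<^esub>}"
    using assms(3) by (auto simp: composition_series_iff[OF L])
  interpret SL: idempotent_semifield "subsemifield_of S L"
    by (rule subsemifield_idempotent_semifield[OF L])
  have refine: "(\<exists>Ms. chain_refinement S L Ks Ms \<and> composition_series S L Ms \<and>
        equivalent_chains S Ms Cs) \<and> chain_length Ks \<le> chain_length Cs"
    if chain: "subkernel_chain S L Ks" for Ks
  proof -
    obtain ks where Ks: "Ks = L # ks"
      using chain by (cases Ks) (auto simp: subkernel_chain_def)
    have "\<forall>K\<in>set ks. semifield_kernel K S" "sorted_wrt (\<supset>) (L # ks)"
      using chain Ks by (auto simp: subkernel_chain_def subkernel_def)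
    from cover_path_refine[OF cs this] obtain ms where ms: "cover_path S L ms {\<one>\<^bsub>S\<^esub>}"
      "mset (factors S L ms) = mset (factors S L cs)" "subseq ks ms" by blast
    have "composition_series S L (L # ms)"
      using ms by (simp add: composition_series_iff[OF L])
    moreover from this have "chain_refinement S L Ks (L # ms)"
      using chain ms Ks by (simp add: chain_refinement_def composition_series_def)
    \<comment> \<open>Equal multisets of factors force equal lengths; as \<open>ks\<close> is a
      subsequence of \<open>ms\<close>, this bounds the length of the given chain.\<close>
    moreover have "length ms = length cs"
      using mset_eq_length[OF ms(2)] by (simp add: length_factors)
    ultimately show ?thesis
      using equivalent_chainsI[OF ms(2)] list_emb_length[OF ms(3)] Ks Cs
      by (auto simp: chain_length_def)
  qed
  have unique: "equivalent_chains S Ks Ms"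
    if "composition_series S L Ks" "composition_series S L Ms" for Ks Ms
    using that cover_path_unique equivalent_chainsI by (fastforce simp: composition_series_iff[OF L])
  have additive: "has_composition_series S K \<and>
      has_composition_series (kernel_quotient S L K) (carrier (kernel_quotient S L K)) \<and>
      kernel_length S L =
        kernel_length S K + kernel_length (kernel_quotient S L K) (carrier (kernel_quotient S L K))"
    if "subkernel S L K" for K
  proof -
    let ?Q = "kernel_quotient S L K"
    have K: "semifield_kernel K S" "K \<subseteq> L" using that by (auto simp: subkernel_def)
    obtain us vs where us: "cover_path S L us K" and vs: "cover_path S K vs {\<one>\<^bsub>S\<^esub>}"
      and f: "mset (factors S L us) + mset (factors S K vs) = mset (factors S L cs)"
      using cover_path_through[OF cs K] by blast
    interpret Q: idempotent_semifield ?Q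
      by (rule kernel_quotient_idempotent_semifield[OF L K])
    have Q: "cover_path ?Q (carrier ?Q) (map ((`) ((#>\<^bsub>S\<^esub>) K)) us) {\<one>\<^bsub>?Q\<^esub>}"
      using us by (intro epi_cover_path[OF L kernel_quotient_epi(1)[OF L K]])
        (simp add: kernel_quotient_epi(2)[OF L K])
    \<comment> \<open>Counting the factors in the multiset identity gives additivity of length:
      \<open>us\<close> has the length of the quotient and \<open>vs\<close> that of
      \<open>K\<close>.\<close>
    have "size (mset (factors S L us) + mset (factors S K vs)) = size (mset (factors S L cs))"
      using f by simp
    then have "length us + length vs = length cs" by (simp add: length_factors)
    then show ?thesis
      using kernel_length_eq[OF L cs] kernel_length_eq[OF K(1) vs]
        Q.kernel_length_eq[OF Q.kernel_carrier Q] vs Q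
      by (auto simp: has_composition_series_def composition_series_iff[OF K(1)]
          Q.composition_series_iff[OF Q.kernel_carrier])
  qed
  have image: "has_composition_series (subsemifield_of T (h ` L)) (h ` L)"
    if T: "semifield T" and h: "h \<in> semifield_hom (subsemifield_of S L) T"
    for T :: "('b, 'n) semifield_scheme" and h
  proof -
    let ?T = "subsemifield_of T (h ` L)"
    interpret T: semifield T by fact
    interpret h: group_hom "subsemifield_of S L" T h
      using h by unfold_locales (simp add: semifield_hom_def)
    \<comment> \<open>Restricting the codomain to the image makes \<open>h\<close> surjective, so
      the results on \<open>semifield_epi\<close> become available.\<close>
    have hom: "h \<in> semifield_hom (subsemifield_of S L) ?T"
      using semifield_homD[OF h] by (intro semifield_homI) (auto simp: subsemifield_of_def)
    have surj: "h ` carrier (subsemifield_of S L) = carrier ?T" by (simp add: subsemifield_of_def)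
    interpret IT: idempotent_semifield ?T
      by (rule idempotent_semifield_image[OF SL.idempotent_semifield_axioms hom surj])
        (use h.hom_one in \<open>simp add: subsemifield_of_def\<close>)
    interpret E: semifield_epi "subsemifield_of S L" ?T h
      using hom surj by unfold_locales
    \<comment> \<open>The kernel of \<open>h\<close> is at first a kernel of \<open>L\<close>; being
      one of \<open>S\<close> as well, it can be inserted into the given series.\<close>
    have ker: "semifield_kernel E.hker S" "E.hker \<subseteq> L"
      using E.kernel_hker by (auto simp: kernel_subsemifield_iff[OF L])
    obtain us where "cover_path S L us E.hker"
      using cover_path_through[OF cs ker] by blast
    from epi_cover_path[OF L E.semifield_epi_axioms this]
    show ?thesis
      using IT.composition_series_iff[OF IT.kernel_carrier]
      by (auto simp: has_composition_series_def subsemifield_of_def)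
  qed
  show ?thesis
    using refine unique additive image by blast
qed

end
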